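(* Let $G=(V,E)$ be a connected interval graph and $t\in V$. Then $t$ is the last vertex of some DFS ordering of $G$ if and only if the induced subgraph $G[N(t)]$ contains a hamiltonian path.
   Context: An interval graph is the intersection graph of a family of intervals on the real line. $N(t)$ is the set of neighbours of $t$. A DFS ordering is an ordering obtained by starting at an arbitrary vertex and, at each step, visiting next an unvisited neighbour of the most recently visited vertex that still has an unvisited neighbour (backtracking as needed), with arbitrary tie-breaks. *)

theory Defs
  imports "HOL-Analysis.Analysis" "Graph_Theory.Graph_Theory"
begin

text \<open>
  Finite simple undirected graphs are the symmetric loop-free digraphs of the locale
  \<^locale>\<open>pair_graph\<close>: an edge is represented by its two arcs.
\<close>

definition neighbourhood :: "'a pair_pre_digraph \<Rightarrow> 'a \<Rightarrow> 'a set" where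
  "neighbourhood G v = {u \<in> pverts G. (v, u) \<in> parcs G}"

text \<open>
  The intervals are arbitrary (open, closed, half-open, bounded or not). Distinct vertices may
  be represented by the same interval.
\<close>

definition interval_graph :: "'a pair_pre_digraph \<Rightarrow> bool" where
  "interval_graph G \<longleftrightarrow>
    (\<exists>I :: 'a \<Rightarrow> real set.
      (\<forall>v \<in> pverts G. is_interval (I v) \<and> I v \<noteq> {}) \<and>
      (\<forall>u \<in> pverts G. \<forall>v \<in> pverts G. u \<noteq> v \<longrightarrow> ((u, v) \<in> parcs G \<longleftrightarrow> I u \<inter> I v \<noteq> {})))"

text \<open>
  \<open>dfs_prefix G xs\<close>: the list \<open>xs\<close> gives, in the order of their visits, the vertices visited so far
  by some depth-first search of \<open>G\<close>. In the rule \<open>step\<close> none of the vertices \<open>ys\<close> visited after \<open>u\<close>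
  has an unvisited neighbour, so \<open>u\<close> is the most recently visited vertex that still has one.
\<close>

inductive dfs_prefix :: "'a pair_pre_digraph \<Rightarrow> 'a list \<Rightarrow> bool" for G where
  start: "s \<in> pverts G \<Longrightarrow> dfs_prefix G [s]"
| step: "\<lbrakk>dfs_prefix G (xs @ u # ys);
          \<forall>y \<in> set ys. neighbourhood G y \<subseteq> set (xs @ u # ys);
          w \<in> neighbourhood G u; w \<notin> set (xs @ u # ys)\<rbrakk>
         \<Longrightarrow> dfs_prefix G (xs @ u # ys @ [w])"

definition dfs_ordering :: "'a pair_pre_digraph \<Rightarrow> 'a list \<Rightarrow> bool" where
  "dfs_ordering G xs \<longleftrightarrow> dfs_prefix G xs \<and> set xs = pverts G"

text \<open>
  \<^const>\<open>vpath\<close> only admits non-empty vertex sequences. The empty sequence is added as a hamiltonian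
  path of the graph without vertices, which arises as the subgraph induced by the neighbourhood of
  the vertex of a one-vertex graph.
\<close>

definition hamiltonian_path :: "('a, 'b) pre_digraph \<Rightarrow> 'a list \<Rightarrow> bool" where
  "hamiltonian_path H p \<longleftrightarrow> (p = [] \<or> vpath p H) \<and> set p = verts H"

end

theory Submission
  imports Defs
begin

text \<open>
  If \<open>t\<close> is visited last, then just before that every neighbour of \<open>t\<close> still has an unvisited
  neighbour, hence lies on the current branch of the search tree, which is a path of \<open>G - t\<close>.
  Between two consecutive neighbours of \<open>t\<close> on this path, the path stays on one side of the
  interval of \<open>t\<close>; so both neighbours cross the same end of that interval and are adjacent.
  Deleting the other vertices from the branch thus leaves a hamiltonian path of \<open>G[N(t)]\<close>.

  Conversely, a search may follow a hamiltonian path \<open>y\<^sub>1, \<dots>, y\<^sub>m\<close> of \<open>G[N(t)]\<close> and, before leaving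
  \<open>y\<^sub>j\<close>, visit all components of \<open>G - N[t]\<close> that are attached to \<open>y\<^sub>1, \<dots>, y\<^sub>j\<close> only. When \<open>y\<^sub>m\<close> is
  done, \<open>t\<close> is the only vertex left. This direction holds in every connected graph.
\<close>

section \<open>Intervals\<close>

definition precedes :: "real set \<Rightarrow> real set \<Rightarrow> bool" where
  "precedes A B \<longleftrightarrow> (\<forall>a\<in>A. \<forall>b\<in>B. a < b)"

lemma disjoint_intervals_precedes:
  assumes "is_interval A" "is_interval B" "A \<inter> B = {}"
  shows "precedes A B \<or> precedes B A"
proof (rule ccontr)
  assume "\<not> ?thesis"
  then obtain a b a' b' where ab: "a \<in> A" "b \<in> B" "b \<le> a" "a' \<in> A" "b' \<in> B" "a' \<le> b'"
    unfolding precedes_def by (meson not_less)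
  show False
  proof (cases "a \<le> b'")
    case True
    then have "a \<in> B"
      using ab assms(2) by (meson mem_is_interval_1_I)
    then show False using ab assms(3) by blast
  next
    case False
    then have "b' \<in> A"
      using ab assms(1) by (meson mem_is_interval_1_I less_imp_le not_le)
    then show False using ab assms(3) by blast
  qed
qed

text \<open>The side of \<open>T\<close> is passed on along the chain: a point shared by two
  consecutive intervals cannot lie both before and after a point of \<open>T\<close>.\<close>

lemma chain_avoiding_interval_one_sided:
  fixes I :: "'b \<Rightarrow> real set"
  assumes "successively (\<lambda>u v. I u \<inter> I v \<noteq> {}) zs"
    and "\<And>z. z \<in> set zs \<Longrightarrow> is_interval (I z) \<and> I z \<inter> T = {}"
    and "is_interval T" "T \<noteq> {}"
  shows "(\<forall>z\<in>set zs. precedes (I z) T) \<or> (\<forall>z\<in>set zs. precedes T (I z))"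
  using assms(1,2)
proof (induction zs rule: induct_list012)
  case (2 z)
  then show ?case using disjoint_intervals_precedes[of "I z" T] assms(3) by auto
next
  case (3 z z' zs)
  have IH: "(\<forall>z\<in>set (z' # zs). precedes (I z) T) \<or> (\<forall>z\<in>set (z' # zs). precedes T (I z))"
    using 3 by auto
  have side: "precedes (I z) T \<or> precedes T (I z)"
    using disjoint_intervals_precedes[of "I z" T] assms(3) 3 by auto
  obtain p where p: "p \<in> I z" "p \<in> I z'" using 3(3) by auto
  obtain q where q: "q \<in> T" using assms(4) by blast
  have "\<not> (precedes (I z) T \<and> precedes T (I z'))" "\<not> (precedes T (I z) \<and> precedes (I z') T)"
    using p q unfolding precedes_def by (meson less_asym)+
  then show ?case using IH side by auto
qed auto

text \<open>The larger of \<open>p\<close> and \<open>p'\<close> is a common point: it lies between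
  the two given points of the interval it was not taken from.\<close>

lemma intervals_crossing_meet:
  fixes Y Y' :: "real set"
  assumes "is_interval Y" "is_interval Y'" "p \<in> Y" "q \<in> Y" "p' \<in> Y'" "q' \<in> Y'" "p < q'" "p' < q"
  shows "Y \<inter> Y' \<noteq> {}"
proof (cases "p \<le> p'")
  case True
  then have "p' \<in> Y" using assms by (meson mem_is_interval_1_I less_imp_le)
  then show ?thesis using assms by blast
next
  case False
  then have "p \<in> Y'" using assms by (meson mem_is_interval_1_I less_imp_le not_le)
  then show ?thesis using assms by blast
qed

lemma chain_ends_meet:
  fixes I :: "'b \<Rightarrow> real set"
  assumes chain: "successively (\<lambda>u v. I u \<inter> I v \<noteq> {}) (y # zs @ [y'])"
    and iv: "\<And>z. z \<in> set (y # zs @ [y']) \<Longrightarrow> is_interval (I z)"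
    and avoid: "\<And>z. z \<in> set zs \<Longrightarrow> I z \<inter> T = {}"
    and T: "is_interval T" "T \<noteq> {}" "I y \<inter> T \<noteq> {}" "I y' \<inter> T \<noteq> {}"
  shows "I y \<inter> I y' \<noteq> {}"
proof (cases "zs = []")
  case True
  then show ?thesis using chain by simp
next
  case False
  have parts: "successively (\<lambda>u v. I u \<inter> I v \<noteq> {}) zs"
    "I y \<inter> I (hd zs) \<noteq> {}" "I (last zs) \<inter> I y' \<noteq> {}"
    using chain False by (auto simp: successively_Cons successively_append_iff)
  obtain p p' q q' where pq: "p \<in> I y" "p \<in> I (hd zs)" "p' \<in> I y'" "p' \<in> I (last zs)"
      "q \<in> I y" "q \<in> T" "q' \<in> I y'" "q' \<in> T"
    using parts T by blast
  have sides: "(\<forall>z\<in>set zs. precedes (I z) T) \<or> (\<forall>z\<in>set zs. precedes T (I z))"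
    using chain_avoiding_interval_one_sided[OF parts(1) _ T(1,2)] iv avoid by auto
  have ends: "hd zs \<in> set zs" "last zs \<in> set zs" using False by auto
  \<comment> \<open>The points \<open>p\<close> and \<open>p'\<close> of the chain both lie before,
    or both after, the points \<open>q\<close> and \<open>q'\<close> of \<open>T\<close>. Only the
    crosswise comparisons are kept; in the second case \<open>p\<close>, \<open>p'\<close> exchange
    roles with \<open>q\<close>, \<open>q'\<close>.\<close>
  from sides consider "p < q'" "p' < q" | "q < p'" "q' < p"
    using pq ends unfolding precedes_def by metis
  then show ?thesis
  proof cases
    case 1
    then show ?thesis
      using intervals_crossing_meet[of "I y" "I y'" p q p' q'] pq iv by auto
  next
    case 2
    then show ?thesis
      using intervals_crossing_meet[of "I y" "I y'" q p q' p'] pq iv by auto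
  qed
qed

section \<open>The branch of a depth-first search\<close>

context pair_graph
begin

lemma mem_neighbourhood_iff: "u \<in> neighbourhood G v \<longleftrightarrow> (v, u) \<in> parcs G"
  unfolding neighbourhood_def using in_arcsD2 by auto

lemma arcs_sym: "(u, v) \<in> parcs G \<Longrightarrow> (v, u) \<in> parcs G"
  using pair_sym_arcs unfolding symmetric_def by (auto dest: symD)

lemma no_loop: "(u, u) \<notin> parcs G"
  using pair_no_loops by fastforce

lemma dfs_prefix_distinct: "dfs_prefix G xs \<Longrightarrow> distinct xs \<and> set xs \<subseteq> pverts G"
  by (induction rule: dfs_prefix.induct) (auto simp: neighbourhood_def)

text \<open>\<open>S\<close> is the current branch, that is, the search stack. A set suffices
  because the order along the branch is the order of the visits. The search has backtracked from the
  visited vertices outside \<open>S\<close>, so these have no unvisited neighbour.\<close>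

lemma dfs_prefix_branch:
  assumes "dfs_prefix G xs"
  shows "\<exists>S. successively (\<lambda>u v. (u, v) \<in> parcs G) (filter (\<lambda>x. x \<in> S) xs) \<and>
    (\<forall>v \<in> set xs - S. neighbourhood G v \<subseteq> set xs)"
  using assms
proof (induction rule: dfs_prefix.induct)
  case (start s)
  show ?case by (intro exI[of _ "{s}"]) auto
next
  case (step xs u ys w)
  let ?E = "\<lambda>u v. (u, v) \<in> parcs G"
  obtain S where S: "successively ?E (filter (\<lambda>x. x \<in> S) (xs @ u # ys))"
    "\<forall>v \<in> set (xs @ u # ys) - S. neighbourhood G v \<subseteq> set (xs @ u # ys)"
    using step.IH by blast
  \<comment> \<open>\<open>w\<close> is an unvisited neighbour of \<open>u\<close>, so
    \<open>u\<close> cannot be off the branch.\<close>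
  have u: "u \<in> S" using S(2) step.hyps by auto
  \<comment> \<open>Backtracking to \<open>u\<close> removes from the branch whatever was visited
    after \<open>u\<close>.\<close>
  define S' where "S' = (S - set ys) \<union> {w}"
  have dist: "distinct (xs @ u # ys @ [w])"
    using dfs_prefix_distinct[OF step.hyps(1)] step.hyps(4) by auto
  have "filter (\<lambda>x. x \<in> S') xs = filter (\<lambda>x. x \<in> S) xs"
    using dist by (intro filter_cong) (auto simp: S'_def)
  moreover have "filter (\<lambda>x. x \<in> S') ys = []"
    using dist by (auto simp: S'_def filter_empty_conv)
  ultimately have filt: "filter (\<lambda>x. x \<in> S') (xs @ u # ys @ [w]) = filter (\<lambda>x. x \<in> S) xs @ [u, w]"
    using dist u by (auto simp: S'_def)
  have "(u, w) \<in> parcs G" using step.hyps(3) by (simp add: mem_neighbourhood_iff)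
  then have "successively ?E (filter (\<lambda>x. x \<in> S') (xs @ u # ys @ [w]))"
    using S(1) u unfolding filt by (auto simp: successively_append_iff)
  moreover have "\<forall>v \<in> set (xs @ u # ys @ [w]) - S'. neighbourhood G v \<subseteq> set (xs @ u # ys @ [w])"
    using S(2) step.hyps(2) unfolding S'_def by auto
  ultimately show ?case by blast
qed

lemma neighbourhood_path_if_last:
  assumes "dfs_ordering G xs" "last xs = t"
  obtains Q where "successively (\<lambda>u v. (u, v) \<in> parcs G) Q" "distinct Q" "t \<notin> set Q"
    "neighbourhood G t \<subseteq> set Q" "set Q \<subseteq> pverts G"
proof -
  have "dfs_prefix G xs" and all: "set xs = pverts G"
    using assms(1) unfolding dfs_ordering_def by auto
  note dist = dfs_prefix_distinct[OF this(1)]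
  from \<open>dfs_prefix G xs\<close> show thesis
  proof cases
    case (start s)
    then have "pverts G = {t}" using all assms(2) by auto
    then have "neighbourhood G t = {}"
      using no_loop unfolding neighbourhood_def by auto
    then show thesis using that[of "[]"] by auto
  next
    case (step ys u zs w)
    have w: "w = t" using step(1) assms(2) by simp
    \<comment> \<open>The branch is read off just before the last step, when \<open>t\<close> is
      still an unvisited neighbour of each \<open>v\<close> in its neighbourhood.\<close>
    let ?P = "ys @ u # zs"
    obtain S where S: "successively (\<lambda>u v. (u, v) \<in> parcs G) (filter (\<lambda>x. x \<in> S) ?P)"
      "\<forall>v \<in> set ?P - S. neighbourhood G v \<subseteq> set ?P"
      using dfs_prefix_branch[OF step(2)] by blast
    have t: "t \<notin> set ?P" and verts: "pverts G = insert t (set ?P)"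
      using dist all w unfolding step(1) by auto
    show thesis
    proof (rule that[OF S(1)])
      show "neighbourhood G t \<subseteq> set (filter (\<lambda>x. x \<in> S) ?P)"
      proof
        fix v assume "v \<in> neighbourhood G t"
        then have "t \<in> neighbourhood G v" "v \<noteq> t" "v \<in> pverts G"
          using arcs_sym no_loop in_arcsD2 by (auto simp: mem_neighbourhood_iff)
        moreover from this have "v \<in> set ?P" using verts by auto
        ultimately show "v \<in> set (filter (\<lambda>x. x \<in> S) ?P)" using S(2) t by auto
      qed
    qed (use t dist step(1) in auto)
  qed
qed

text \<open>Putting \<open>y\<close> in front requires one new adjacency, to the next neighbour
  \<open>y'\<close> of \<open>t\<close> on the path. The vertices skipped between them have
  intervals missing \<open>I t\<close>, so \<open>chain_ends_meet\<close> applies with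
  \<open>T = I t\<close>.\<close>

lemma filter_neighbourhood_successively:
  assumes interval: "\<And>v. v \<in> pverts G \<Longrightarrow> is_interval (I v) \<and> I v \<noteq> ({} :: real set)"
    and adj: "\<And>u v. u \<in> pverts G \<Longrightarrow> v \<in> pverts G \<Longrightarrow> u \<noteq> v \<Longrightarrow> (u, v) \<in> parcs G \<longleftrightarrow> I u \<inter> I v \<noteq> {}"
    and t: "t \<in> pverts G"
    and walk: "successively (\<lambda>u v. (u, v) \<in> parcs G) Q"
    and Q: "distinct Q" "t \<notin> set Q" "set Q \<subseteq> pverts G"
  shows "successively (\<lambda>u v. (u, v) \<in> parcs G) (filter (\<lambda>x. x \<in> neighbourhood G t) Q)"
  using walk Q
proof (induction Q)
  case (Cons y Q)
  let ?N = "neighbourhood G t"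
  have IH: "successively (\<lambda>u v. (u, v) \<in> parcs G) (filter (\<lambda>x. x \<in> ?N) Q)"
    using Cons by (auto simp: successively_Cons)
  show ?case
  proof (cases "y \<in> ?N \<and> filter (\<lambda>x. x \<in> ?N) Q \<noteq> []")
    case True
    then obtain y' R where R: "filter (\<lambda>x. x \<in> ?N) Q = y' # R"
      by (cases "filter (\<lambda>x. x \<in> ?N) Q") auto
    then obtain zs vs where Q: "Q = zs @ y' # vs" "\<forall>z\<in>set zs. z \<notin> ?N" "y' \<in> ?N"
      unfolding filter_eq_Cons_iff by blast
    let ?L = "y # zs @ [y']"
    have "successively (\<lambda>u v. (u, v) \<in> parcs G) (?L @ vs)"
      using Cons.prems(1) unfolding Q by simp
    then have "successively (\<lambda>u v. (u, v) \<in> parcs G) ?L"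
      unfolding successively_append_iff by blast
    then have "successively (\<lambda>u v. I u \<inter> I v \<noteq> {}) ?L"
      by (rule successively_mono) (metis adj in_arcsD1 in_arcsD2 no_loop)
    moreover have "is_interval (I z)" if "z \<in> set ?L" for z
      using that interval Cons.prems(4) Q by auto
    moreover have "I z \<inter> I t = {}" if "z \<in> set zs" for z
      using that adj[of t z] t Cons.prems(3,4) Q by (auto simp: mem_neighbourhood_iff)
    moreover have "I z \<inter> I t \<noteq> {}" if "z \<in> {y, y'}" for z
      using that adj[of t z] t Cons.prems(3,4) Q True by (auto simp: mem_neighbourhood_iff)
    ultimately have "I y \<inter> I y' \<noteq> {}"
      using chain_ends_meet[of I y zs y' "I t"] interval[OF t] by auto
    then have "(y, y') \<in> parcs G"
      using adj[of y y'] Cons.prems(2,4) Q by auto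
    then show ?thesis using True IH R by simp
  next
    case False
    then show ?thesis using IH by auto
  qed
qed auto

section \<open>A depth-first search along a path of the neighbourhood\<close>

text \<open>The search is continued from \<open>u\<close> inside \<open>T\<close> for as long as
  possible; it stops because each step visits a new vertex of \<open>T\<close>.\<close>

lemma dfs_explore:
  assumes "dfs_prefix G (xs @ u # ys)" "set ys \<subseteq> T" "finite T"
    and closed: "\<And>v. v \<in> T \<Longrightarrow> neighbourhood G v \<subseteq> T \<union> set (xs @ [u])"
  shows "\<exists>zs. dfs_prefix G (xs @ u # zs) \<and> set zs \<subseteq> T \<and>
    (\<forall>z \<in> set (u # zs). neighbourhood G z \<inter> T \<subseteq> set (xs @ u # zs))"
  using assms(1,2)
proof (induction "card (T - set ys)" arbitrary: ys rule: less_induct)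
  case less
  let ?P = "\<lambda>z. \<not> neighbourhood G z \<inter> T \<subseteq> set (xs @ u # ys)"
  show ?case
  proof (cases "\<exists>z \<in> set (u # ys). ?P z")
    case True
    \<comment> \<open>The last vertex with an unvisited neighbour in \<open>T\<close> is the one
      from which the rule \<open>step\<close> has to continue.\<close>
    then obtain as v bs where split: "u # ys = as @ v # bs" "?P v" "\<forall>z\<in>set bs. \<not> ?P z"
      by (rule split_list_last_propE)
    then obtain w where w: "w \<in> neighbourhood G v" "w \<in> T" "w \<notin> set (xs @ u # ys)" by blast
    have eq: "xs @ u # ys = (xs @ as) @ v # bs" using split(1) by simp
    have "set bs \<subseteq> set ys" using split(1) by (cases as) auto
    \<comment> \<open>The vertices of \<open>bs\<close> lie in \<open>T\<close>, so their neighbours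
      outside \<open>T\<close> are in \<open>xs @ [u]\<close>, hence visited; no unvisited neighbour
      remains at all.\<close>
    then have "\<forall>z\<in>set bs. neighbourhood G z \<subseteq> set (xs @ u # ys)"
      using split(3) closed less.prems(2) by fastforce
    then have "dfs_prefix G ((xs @ as) @ v # bs @ [w])"
      using w less.prems(1) unfolding eq by (intro dfs_prefix.step) auto
    moreover have "(xs @ as) @ v # bs @ [w] = xs @ u # (ys @ [w])"
      using arg_cong[OF eq, of "\<lambda>l. l @ [w]"] by simp
    ultimately have "dfs_prefix G (xs @ u # (ys @ [w]))" by (simp only:)
    moreover have "card (T - set (ys @ [w])) < card (T - set ys)"
      using w \<open>finite T\<close> by (intro psubset_card_mono) auto
    ultimately show ?thesis using less.hyps[of "ys @ [w]"] less.prems(2) w(2) by auto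
  next
    case False
    then show ?thesis using less.prems by blast
  qed
qed

end

text \<open>
  With \<open>A\<close> the set of vertices outside \<open>N[t]\<close>, this is the union of the components of \<open>G[A]\<close>
  whose neighbours outside \<open>A\<close> all lie in \<open>S\<close>.
\<close>

definition enclosed :: "'a pair_pre_digraph \<Rightarrow> 'a set \<Rightarrow> 'a set \<Rightarrow> 'a set" where
  "enclosed G A S = \<Union>{T. T \<subseteq> A \<and> (\<forall>v\<in>T. neighbourhood G v \<subseteq> T \<union> S)}"

lemma enclosed_subset: "enclosed G A S \<subseteq> A"
  unfolding enclosed_def by blast

text \<open>The defining property survives unions, so \<open>enclosed G A S\<close> has it too and,
  by \<open>enclosed_greatest\<close>, is the largest such set.\<close>

lemma enclosed_neighbourhood:
  assumes "v \<in> enclosed G A S"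
  shows "neighbourhood G v \<subseteq> enclosed G A S \<union> S"
proof -
  obtain T where "v \<in> T" "T \<subseteq> A" "\<forall>v\<in>T. neighbourhood G v \<subseteq> T \<union> S"
    using assms unfolding enclosed_def by auto
  then show ?thesis unfolding enclosed_def by auto
qed

lemma enclosed_greatest:
  "T \<subseteq> A \<Longrightarrow> (\<And>v. v \<in> T \<Longrightarrow> neighbourhood G v \<subseteq> T \<union> S) \<Longrightarrow> T \<subseteq> enclosed G A S"
  unfolding enclosed_def by (intro Union_upper) simp

lemma enclosed_mono: "S \<subseteq> S' \<Longrightarrow> enclosed G A S \<subseteq> enclosed G A S'"
  using enclosed_neighbourhood[of _ G A S]
  by (intro enclosed_greatest enclosed_subset) (rule subset_trans, assumption, auto)

context pair_graph
begin

text \<open>This is one stage of the search along the path: after reaching \<open>u\<close>,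
  everything newly enclosed is visited before \<open>u\<close> is left for good.\<close>

lemma dfs_visit_enclosed:
  assumes pre: "dfs_prefix G (xs @ [u])" and visited: "set xs = S \<union> enclosed G A S"
    and A: "finite A" "u \<notin> A" "S \<inter> A = {}"
  shows "\<exists>zs. dfs_prefix G (xs @ u # zs) \<and> (\<forall>z\<in>set zs. neighbourhood G z \<subseteq> set (xs @ u # zs)) \<and>
    set (xs @ u # zs) = insert u S \<union> enclosed G A (insert u S)"
proof -
  let ?T = "enclosed G A (insert u S)"
  have T: "?T \<subseteq> A" "enclosed G A S \<subseteq> ?T"
    by (rule enclosed_subset) (rule enclosed_mono, blast)
  have closed: "neighbourhood G v \<subseteq> ?T \<union> set (xs @ [u])" if "v \<in> ?T" for v
    using enclosed_neighbourhood[OF that] visited by auto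
  obtain zs where zs: "dfs_prefix G (xs @ u # zs)" "set zs \<subseteq> ?T"
    "\<forall>z \<in> set (u # zs). neighbourhood G z \<inter> ?T \<subseteq> set (xs @ u # zs)"
    using dfs_explore[of xs u "[]" ?T] pre closed finite_subset[OF T(1) A(1)] by auto
  have finished: "neighbourhood G z \<subseteq> set (xs @ u # zs)" if "z \<in> set zs" for z
    using that zs(2,3) closed by fastforce
  \<comment> \<open>A leftover vertex is adjacent neither to \<open>u\<close> nor to
    \<open>zs\<close>, as these have no unvisited neighbour in \<open>?T\<close>. So
    \<open>R\<close> is attached to \<open>S\<close> only, was already enclosed by \<open>S\<close>,
    and hence had been visited.\<close>
  define R where "R = ?T - set (xs @ u # zs)"
  have "R \<subseteq> enclosed G A S"
  proof (rule enclosed_greatest)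
    show "R \<subseteq> A" using T(1) unfolding R_def by blast
    fix v assume v: "v \<in> R"
    show "neighbourhood G v \<subseteq> R \<union> S"
    proof
      fix w assume w: "w \<in> neighbourhood G v"
      then have vw: "v \<in> neighbourhood G w" using arcs_sym by (simp add: mem_neighbourhood_iff)
      have "w \<noteq> u" using vw v zs(3) unfolding R_def by auto
      moreover have "w \<notin> set zs" using vw v finished unfolding R_def by blast
      moreover have "w \<notin> enclosed G A S"
        using vw v enclosed_neighbourhood[of w G A S] visited unfolding R_def by auto
      moreover have "w \<in> ?T \<union> insert u S"
        using enclosed_neighbourhood[of v G A "insert u S"] v w unfolding R_def by blast
      ultimately show "w \<in> R \<union> S" using visited unfolding R_def by auto
    qed
  qed
  then have "R = {}" using visited unfolding R_def by auto
  then have "set (xs @ u # zs) = insert u S \<union> ?T"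
    using zs(2) visited T(2) unfolding R_def by auto
  then show ?thesis using zs(1) finished by blast
qed

lemma closed_imp_all:
  assumes "Digraph_Component.connected (with_proj G)"
    and "C \<subseteq> pverts G" "C \<noteq> {}" "\<And>v. v \<in> C \<Longrightarrow> neighbourhood G v \<subseteq> C"
  shows "C = pverts G"
proof -
  obtain v where v: "v \<in> C" using assms(3) by blast
  have "w \<in> C" if "w \<in> pverts G" for w
  proof -
    have "v \<rightarrow>\<^sup>*\<^bsub>mk_symmetric (with_proj G)\<^esub> w"
      using assms(1,2) v that unfolding Digraph_Component.connected_def strongly_connected_def
      by auto
    then have "v \<rightarrow>\<^sup>*\<^bsub>with_proj G\<^esub> w"
      using reachable_mk_symmetric_eq[OF pair_sym_arcs] by simp
    then show ?thesis
    proof (induction rule: reachable_induct)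
      case base
      then show ?case using v by simp
    next
      case (step x y)
      then show ?case using assms(4)[of x] by (auto simp: mem_neighbourhood_iff)
    qed
  qed
  then show ?thesis using assms(2) by blast
qed

text \<open>The path grows at its end. The clause on \<open>zs\<close> allows the search to
  backtrack to \<open>last ps\<close>, from where it steps to the next path vertex.\<close>

lemma dfs_along_path:
  assumes "Digraph_Component.connected (with_proj G)"
    and A: "A \<subset> pverts G"
    and "ps \<noteq> []" "distinct ps" "set ps \<subseteq> pverts G - A"
    and "successively (\<lambda>u v. (u, v) \<in> parcs G) ps"
  shows "\<exists>xs zs. dfs_prefix G (xs @ last ps # zs) \<and>
    (\<forall>z\<in>set zs. neighbourhood G z \<subseteq> set (xs @ last ps # zs)) \<and>
    set (xs @ last ps # zs) = set ps \<union> enclosed G A (set ps)"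
proof -
  have fin: "finite A" using A pair_finite_verts finite_subset by blast
  from assms(3-) show ?thesis
  proof (induction ps rule: rev_nonempty_induct)
    case (single y)
    \<comment> \<open>A nonempty set enclosed by nothing is closed under neighbours, hence all of
      \<open>pverts G\<close> by connectedness, but \<open>A\<close> is a proper subset.\<close>
    have "enclosed G A {} = {}"
    proof (rule ccontr)
      assume "enclosed G A {} \<noteq> {}"
      then have "enclosed G A {} = pverts G"
        using enclosed_subset[of G A "{}"] enclosed_neighbourhood[of _ G A "{}"] A
        by (intro closed_imp_all[OF assms(1)]) auto
      then show False using enclosed_subset[of G A "{}"] A by blast
    qed
    moreover have "dfs_prefix G ([] @ [y])" using single by (simp add: dfs_prefix.start)
    ultimately obtain zs where "dfs_prefix G ([] @ y # zs)"
      "\<forall>z\<in>set zs. neighbourhood G z \<subseteq> set ([] @ y # zs)"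
      "set ([] @ y # zs) = {y} \<union> enclosed G A {y}"
      using dfs_visit_enclosed[of "[]" y "{}" A] fin single by auto
    then show ?case by (intro exI[of _ "[]"] exI[of _ zs]) simp
  next
    case (snoc y ps)
    let ?x = "last ps"
    obtain xs zs where IH: "dfs_prefix G (xs @ ?x # zs)"
      "\<forall>z\<in>set zs. neighbourhood G z \<subseteq> set (xs @ ?x # zs)"
      "set (xs @ ?x # zs) = set ps \<union> enclosed G A (set ps)"
      using snoc by (auto simp: successively_append_iff)
    have "y \<in> neighbourhood G ?x"
      using snoc.prems(3) snoc.hyps by (auto simp: successively_append_iff mem_neighbourhood_iff)
    moreover have "y \<notin> set (xs @ ?x # zs)"
      unfolding IH(3) using snoc.prems(1,2) enclosed_subset[of G A "set ps"] by auto
    ultimately have pre: "dfs_prefix G ((xs @ ?x # zs) @ [y])"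
      using dfs_prefix.step[OF IH(1,2)] by simp
    have disj: "y \<notin> A" "set ps \<inter> A = {}" using snoc.prems(2) by auto
    from pre obtain zs' where "dfs_prefix G ((xs @ ?x # zs) @ y # zs')"
      "\<forall>z\<in>set zs'. neighbourhood G z \<subseteq> set ((xs @ ?x # zs) @ y # zs')"
      "set ((xs @ ?x # zs) @ y # zs') = insert y (set ps) \<union> enclosed G A (insert y (set ps))"
      using dfs_visit_enclosed[OF _ IH(3) fin, of y] disj by blast
    then show ?case by (intro exI[of _ "xs @ ?x # zs"] exI[of _ zs']) simp
  qed
qed

lemma last_if_neighbourhood_path:
  assumes conn: "Digraph_Component.connected (with_proj G)" and t: "t \<in> pverts G"
    and p: "distinct p" "set p = neighbourhood G t" "successively (\<lambda>u v. (u, v) \<in> parcs G) p"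
  shows "\<exists>xs. dfs_ordering G xs \<and> last xs = t"
proof (cases "p = []")
  case True
  then have "{t} = pverts G"
    using closed_imp_all[OF conn, of "{t}"] p(2) t by auto
  then show ?thesis
    using dfs_prefix.start[OF t] by (intro exI[of _ "[t]"]) (auto simp: dfs_ordering_def)
next
  case False
  define A where "A = pverts G - insert t (neighbourhood G t)"
  have N: "set p \<subseteq> pverts G" "t \<notin> set p"
    using p(2) no_loop unfolding neighbourhood_def by auto
  have A: "A \<subset> pverts G" using t unfolding A_def by auto
  obtain xs zs where D: "dfs_prefix G (xs @ last p # zs)"
    "\<forall>z\<in>set zs. neighbourhood G z \<subseteq> set (xs @ last p # zs)"
    "set (xs @ last p # zs) = set p \<union> enclosed G A (set p)"
    using dfs_along_path[OF conn A False p(1) _ p(3)] N p(2) unfolding A_def by blast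
  \<comment> \<open>Once the whole path is visited, nothing in \<open>A\<close> is held back:
    vertices of \<open>A\<close> are not adjacent to \<open>t\<close>, so their neighbours lie in
    \<open>A\<close> or on \<open>p\<close>.\<close>
  have "A \<subseteq> enclosed G A (set p)"
  proof (rule enclosed_greatest)
    fix v assume "v \<in> A"
    then have "t \<notin> neighbourhood G v"
      unfolding A_def using arcs_sym by (auto simp: mem_neighbourhood_iff)
    then show "neighbourhood G v \<subseteq> A \<union> set p"
      unfolding A_def p(2) using in_arcsD2 by (auto simp: mem_neighbourhood_iff)
  qed simp
  then have visited: "set (xs @ last p # zs) = pverts G - {t}"
    unfolding D(3) using enclosed_subset[of G A "set p"] N p(2) unfolding A_def by auto
  have "last p \<in> neighbourhood G t" using last_in_set[OF False] unfolding p(2) .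
  then have "t \<in> neighbourhood G (last p)" using arcs_sym by (simp add: mem_neighbourhood_iff)
  then have "dfs_prefix G (xs @ last p # zs @ [t])"
    using D(2) visited by (intro dfs_prefix.step[OF D(1)]) auto
  moreover have "set (xs @ last p # zs @ [t]) = pverts G" using visited t by auto
  ultimately show ?thesis
    unfolding dfs_ordering_def by (intro exI[of _ "xs @ last p # zs @ [t]"]) auto
qed

end

section \<open>The characterization\<close>

lemma set_vwalk_arcs_subset_iff:
  "set (vwalk_arcs p) \<subseteq> E \<longleftrightarrow> successively (\<lambda>u v. (u, v) \<in> E) p"
  by (induction p rule: vwalk_arcs.induct) auto

text \<open>As \<open>p\<close> runs through exactly the vertices of \<open>S\<close>, its arcs lie
  in \<open>S \<times> S\<close> anyway and can be tested in \<open>G\<close>.\<close>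

lemma hamiltonian_path_induce_subgraph_iff:
  "hamiltonian_path (with_proj G \<restriction> S) p \<longleftrightarrow>
    distinct p \<and> set p = S \<and> successively (\<lambda>u v. (u, v) \<in> parcs G) p"
proof -
  have "arcs_ends (with_proj G \<restriction> S) = parcs G \<inter> S \<times> S"
    by (auto simp: arcs_ends_conv)
  moreover have "set (vwalk_arcs p) \<subseteq> set p \<times> set p"
    by (induction p rule: vwalk_arcs.induct) auto
  ultimately have "set (vwalk_arcs p) \<subseteq> arcs_ends (with_proj G \<restriction> S) \<longleftrightarrow>
      successively (\<lambda>u v. (u, v) \<in> parcs G) p" if "set p = S"
    using that set_vwalk_arcs_subset_iff[of p "parcs G"] by blast
  then show ?thesis
    unfolding hamiltonian_path_def vpath_def vwalk_def induce_subgraph_verts by fastforce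
qed

theorem theorem22:
  fixes G :: "'a pair_pre_digraph" and t :: 'a
  assumes "pair_graph G"
    and "Digraph_Component.connected (with_proj G)"
    and "interval_graph G"
    and "t \<in> pverts G"
  shows "(\<exists>xs. dfs_ordering G xs \<and> last xs = t) \<longleftrightarrow>
         (\<exists>p. hamiltonian_path (with_proj G \<restriction> neighbourhood G t) p)"
proof
  interpret pair_graph G by fact
  assume "\<exists>xs. dfs_ordering G xs \<and> last xs = t"
  then obtain Q where Q: "successively (\<lambda>u v. (u, v) \<in> parcs G) Q" "distinct Q" "t \<notin> set Q"
    "neighbourhood G t \<subseteq> set Q" "set Q \<subseteq> pverts G"
    using neighbourhood_path_if_last by blast
  obtain I :: "'a \<Rightarrow> real set" where I:
    "\<forall>v \<in> pverts G. is_interval (I v) \<and> I v \<noteq> {}"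
    "\<forall>u \<in> pverts G. \<forall>v \<in> pverts G. u \<noteq> v \<longrightarrow> ((u, v) \<in> parcs G \<longleftrightarrow> I u \<inter> I v \<noteq> {})"
    using assms(3) unfolding interval_graph_def by (elim exE conjE)
  have "successively (\<lambda>u v. (u, v) \<in> parcs G) (filter (\<lambda>x. x \<in> neighbourhood G t) Q)"
  proof (rule filter_neighbourhood_successively[where I = I, OF _ _ assms(4) Q(1,2,3,5)])
    show "is_interval (I v) \<and> I v \<noteq> {}" if "v \<in> pverts G" for v
      using I(1) that by (rule bspec)
    show "(u, v) \<in> parcs G \<longleftrightarrow> I u \<inter> I v \<noteq> {}"
      if "u \<in> pverts G" "v \<in> pverts G" "u \<noteq> v" for u v
      using I(2)[rule_format, OF that] .
  qed
  then have "hamiltonian_path (with_proj G \<restriction> neighbourhood G t)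
      (filter (\<lambda>x. x \<in> neighbourhood G t) Q)"
    using Q unfolding hamiltonian_path_induce_subgraph_iff by auto
  then show "\<exists>p. hamiltonian_path (with_proj G \<restriction> neighbourhood G t) p" ..
next
  interpret pair_graph G by fact
  assume "\<exists>p. hamiltonian_path (with_proj G \<restriction> neighbourhood G t) p"
  then show "\<exists>xs. dfs_ordering G xs \<and> last xs = t"
    using last_if_neighbourhood_path[OF assms(2,4)]
    unfolding hamiltonian_path_induce_subgraph_iff by blast
qed

end
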